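(* Suppose $G$ is a finite subgroup of $GL_3(\mathbb R)$ that is strictly generated in codimension two, and let $V=\mathbb R^3$. Then the intersection lattice of the closures of the Luna strata of $V/G$ is isomorphic to $\mathcal L_n$ for some $n\in\{2,3\}$.
   Context: For $g\in G$, $V^{\langle g\rangle}$ is the subspace of vectors fixed by $g$; for a subgroup $H\subset G$, $V^H$ is the subspace of vectors fixed by every element of $H$. $G$ is strictly generated in codimension two if it is generated by its elements $g$ with $\operatorname{codim}V^{\langle g\rangle}=2$. A subgroup $H\subset G$ is a stabilizer subgroup if it is the stabilizer $\operatorname{Stab}(v)=\{g\in G\mid gv=v\}$ of some $v\in V$. Let $\pi:V\to V/G$ be the quotient map. For a conjugacy class $\mathcal H$ of stabilizer subgroups, the Luna stratum of $V/G$ associated with $\mathcal H$ is $\pi(\{v\in V\mid \operatorname{Stab}(v)\in\mathcal H\})$; its closure is $\pi(V^H)$ for any $H\in\mathcal H$. The closures of the Luna strata (including $V/G$ itself, which corresponds to the trivial stabilizer) are ordered by reverse inclusion. $\mathcal L_n$ denotes the poset consisting of a minimum $\hat 0$, a maximum $\hat 1$, and $n$ pairwise incomparable elements $l_1,\dots,l_n$ with $\hat 0<l_i<\hat 1$ for all $i$.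
   Formalization: The formal theorem additionally assumes that G fixes no nonzero vector of V; without this the claim fails, since for the trivial group and cyclic rotation groups (e.g. {1, diag(-1,-1,1)}) there are only one or two Luna strata, while L_2 and L_3 have four and five elements. *)

theory Defs
  imports "HOL-Analysis.Analysis" "HOL-Algebra.Generated_Groups"
begin

definition GL :: "(real^'n^'n) monoid" where
  "GL = \<lparr>carrier = {A. invertible A}, monoid.mult = (**), one = mat 1\<rparr>"

definition fixed_space :: "(real^'n^'n) set \<Rightarrow> (real^'n) set" where
  "fixed_space H = {v. \<forall>h\<in>H. h *v v = v}"

(* Meant for linear subspaces only: dim is the dimension of the span. *)
definition codim :: "'a::euclidean_space set \<Rightarrow> nat" where
  "codim S = DIM('a) - dim S"

definition strictly_generated_codim2 :: "(real^'n^'n) set \<Rightarrow> bool" where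
  "strictly_generated_codim2 G \<longleftrightarrow>
     generate GL {g \<in> G. codim (fixed_space {g}) = 2} = G"

definition stab :: "(real^'n^'n) set \<Rightarrow> real^'n \<Rightarrow> (real^'n^'n) set" where
  "stab G v = {g \<in> G. g *v v = v}"

(* The points of V/G are the G-orbits, so V/G has carrier range (quot_map G). *)
definition quot_map :: "(real^'n^'n) set \<Rightarrow> real^'n \<Rightarrow> (real^'n) set" where
  "quot_map G v = (\<lambda>g. g *v v) ` G"

definition quot_space :: "(real^'n^'n) set \<Rightarrow> (real^'n) set topology" where
  "quot_space G =
     topology (\<lambda>U. U \<subseteq> range (quot_map G) \<and> open (quot_map G -` U))"

lemma openin_quot_space:
  "openin (quot_space G) U \<longleftrightarrow> U \<subseteq> range (quot_map G) \<and> open (quot_map G -` U)"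
proof -
  have "istopology (\<lambda>U. U \<subseteq> range (quot_map G) \<and> open (quot_map G -` U))"
    unfolding istopology_def by (auto simp: vimage_Int vimage_Union)
  then show ?thesis
    unfolding quot_space_def by (simp add: topology_inverse')
qed

lemma topspace_quot_space: "topspace (quot_space G) = range (quot_map G)"
proof -
  have "quot_map G -` range (quot_map G) = UNIV"
    by auto
  then have "openin (quot_space G) (range (quot_map G))"
    by (simp add: openin_quot_space)
  then show ?thesis
    using openin_quot_space openin_subset openin_topspace by (metis subset_antisym)
qed

lemma quotient_map_quot_map: "quotient_map euclidean (quot_space G) (quot_map G)"
  unfolding quotient_map_def
  by (auto simp: openin_quot_space topspace_quot_space vimage_def)

definition conj_class :: "(real^'n^'n) set \<Rightarrow> (real^'n^'n) set \<Rightarrow> (real^'n^'n) set set" where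
  "conj_class G H = {(\<lambda>h. g ** h ** matrix_inv g) ` H | g. g \<in> G}"

definition stabilizer_classes :: "(real^'n^'n) set \<Rightarrow> (real^'n^'n) set set set" where
  "stabilizer_classes G = {conj_class G (stab G v) | v. True}"

definition luna_stratum ::
    "(real^'n^'n) set \<Rightarrow> (real^'n^'n) set set \<Rightarrow> (real^'n) set set" where
  "luna_stratum G \<H> = quot_map G ` {v. stab G v \<in> \<H>}"

definition luna_closures :: "(real^'n^'n) set \<Rightarrow> (real^'n) set set set" where
  "luna_closures G =
     {quot_space G closure_of luna_stratum G \<H> | \<H>. \<H> \<in> stabilizer_classes G}"

(* V/G is itself in luna_closures G, as the closure of the principal stratum, so
   the empty family (whose intersection would be UNIV here) is not needed. *)
definition intersection_lattice :: "'a set set \<Rightarrow> 'a set set" where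
  "intersection_lattice \<C> = {\<Inter>\<D> | \<D>. \<D> \<subseteq> \<C> \<and> \<D> \<noteq> {}}"

datatype lpoint = LBot | LAtom nat | LTop

definition L_carrier :: "nat \<Rightarrow> lpoint set" where
  "L_carrier n = {LBot, LTop} \<union> LAtom ` {1..n}"

definition L_le :: "lpoint \<Rightarrow> lpoint \<Rightarrow> bool" where
  "L_le x y \<longleftrightarrow> x = y \<or> x = LBot \<or> y = LTop"

definition poset_isomorphic ::
    "'a set \<Rightarrow> ('a \<Rightarrow> 'a \<Rightarrow> bool) \<Rightarrow> 'b set \<Rightarrow> ('b \<Rightarrow> 'b \<Rightarrow> bool) \<Rightarrow> bool" where
  "poset_isomorphic A leA B leB \<longleftrightarrow>
     (\<exists>f. bij_betw f A B \<and> (\<forall>x\<in>A. \<forall>y\<in>A. leA x y \<longleftrightarrow> leB (f x) (f y)))"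

end

theory Submission
  imports Defs
begin

text \<open>Averaging an inner product over \<open>G\<close> gives an invariant form, so the generators have determinant 1,
  hence every element does, and every nontrivial element fixes exactly a line, its axis.
  The closures of the Luna strata are therefore the whole quotient, the image of \<open>0\<close>, and the images
  of the axes; the images of two axes either coincide or meet only in the image of \<open>0\<close>.
  It remains to count the orbits of axes. Let \<open>N = |G|\<close>, let \<open>m \<ge> 2\<close> be the order of the pointwise
  stabilizer of an axis and \<open>s\<close> the order of its setwise stabilizer; the latter acts by \<open>\<plusminus>1\<close> on the
  axis, so \<open>m \<le> s \<le> 2 m\<close>. The orbit of the axis accounts for \<open>N (m - 1) / s\<close>
  nontrivial elements, which is at least \<open>N / 4\<close>. Since there are \<open>N - 1\<close> of them in total, there
  are at most three orbits. A single orbit would force \<open>m = N\<close>, so \<open>G\<close> would fix a line.\<close>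

subsection \<open>Linear algebra in dimension three and finite matrix groups\<close>

text \<open>\<open>vector [u, v, w]\<close> has \<open>u\<close>, \<open>v\<close>, \<open>w\<close>
  as its rows. The transpose has them as columns, so that kernel vectors become linear relations and
  preimages become expansions.\<close>

lemma matrix_vector_mult_vector_3:
  fixes u v w x :: "real^3"
  shows "transpose (vector [u, v, w]) *v x = x$1 *\<^sub>R u + x$2 *\<^sub>R v + x$3 *\<^sub>R w"
  by (simp add: vec_eq_iff matrix_vector_mult_def transpose_def sum_3 vector_3 algebra_simps)

lemma det_vector_mult:
  fixes A :: "real^3^3"
  shows "det (vector [A *v u, A *v v, A *v w] :: real^3^3) = det A * det (vector [u, v, w] :: real^3^3)"
proof -
  have "(vector [A *v u, A *v v, A *v w] :: real^3^3) = vector [u, v, w] ** transpose A"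
    by (simp add: vec_eq_iff forall_3 matrix_matrix_mult_def matrix_vector_mult_def transpose_def
        sum_3 vector_3 mult.commute)
  then show ?thesis
    by (simp add: det_mul det_transpose)
qed

lemma det_eq_0_imp_kernel:
  fixes A :: "real^'n^'n"
  assumes "det A = 0"
  obtains x where "x \<noteq> 0" "A *v x = 0"
  using assms invertible_det_nz[of A] invertible_left_inverse[of A] matrix_left_invertible_ker[of A]
  by blast

text \<open>A kernel vector of the column matrix is a linear relation; the hypotheses kill its
  coefficients in the order \<open>w\<close>, \<open>v\<close>, \<open>u\<close>. Independence is
  stated stepwise because bases are extended one vector at a time below.\<close>

lemma det_vector_ne_0:
  fixes u v w :: "real^3"
  assumes "u \<noteq> 0" "v \<notin> span {u}" "w \<notin> span {u, v}"
  shows "det (vector [u, v, w] :: real^3^3) \<noteq> 0"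
proof
  assume "det (vector [u, v, w] :: real^3^3) = 0"
  then have "det (transpose (vector [u, v, w]) :: real^3^3) = 0"
    by (simp add: det_transpose)
  then obtain x :: "real^3" where "x \<noteq> 0" "transpose (vector [u, v, w]) *v x = 0"
    by (rule det_eq_0_imp_kernel)
  then have x: "x \<noteq> 0" "x$1 *\<^sub>R u + x$2 *\<^sub>R v + x$3 *\<^sub>R w = 0"
    by (simp_all add: matrix_vector_mult_vector_3 del: transpose_matrix_vector)
  have x3: "x$3 = 0"
  proof (rule ccontr)
    assume "x$3 \<noteq> 0"
    moreover have "x$3 *\<^sub>R w \<in> span {u, v}"
      using x(2) span_add[OF span_scale[OF span_base, of u "{u,v}" "- x$1"] span_scale[OF span_base, of v "{u,v}" "- x$2"]]
      by (simp add: add_eq_0_iff)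
    ultimately show False
      using assms(3) span_scale[of "x$3 *\<^sub>R w" "{u, v}" "inverse (x$3)"] by simp
  qed
  have x2: "x$2 = 0"
  proof (rule ccontr)
    assume "x$2 \<noteq> 0"
    moreover have "x$2 *\<^sub>R v \<in> span {u}"
      using x(2) x3 span_scale[OF span_base, of u "{u}" "- x$1"]
      by (simp add: add_eq_0_iff)
    ultimately show False
      using assms(2) span_scale[of "x$2 *\<^sub>R v" "{u}" "inverse (x$2)"] by simp
  qed
  have "x$1 = 0"
    using x(2) x2 x3 assms(1) by simp
  with x2 x3 x(1) show False
    by (simp add: vec_eq_iff forall_3)
qed

text \<open>By multilinearity \<open>p\<close> and \<open>q\<close> drop out, and the nonzero
  determinant of the basis cancels. Once two eigenvectors with nonzero eigenvalues are known,
  \<open>det A\<close> thus forces the third diagonal entry.\<close>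

lemma det_upper_triangular:
  fixes A :: "real^3^3"
  assumes "u \<noteq> 0" "v \<notin> span {u}" "w \<notin> span {u, v}"
    and "A *v u = a *\<^sub>R u" "A *v v = b *\<^sub>R v" "A *v w = c *\<^sub>R w + p *\<^sub>R u + q *\<^sub>R v"
  shows "det A = a * b * c"
proof -
  have "det (vector [A *v u, A *v v, A *v w] :: real^3^3) = a * b * c * det (vector [u, v, w] :: real^3^3)"
    unfolding assms(4-6) by (simp add: det_3 vector_3 algebra_simps)
  then show ?thesis
    using det_vector_mult[of A u v w] det_vector_ne_0[OF assms(1-3)] by simp
qed

lemma basis_expansion_3:
  fixes u v w x :: "real^3"
  assumes "u \<noteq> 0" "v \<notin> span {u}" "w \<notin> span {u, v}"
  obtains a b c where "x = c *\<^sub>R w + a *\<^sub>R u + b *\<^sub>R v"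
proof -
  let ?M = "transpose (vector [u, v, w]) :: real^3^3"
  have "invertible ?M"
    using det_vector_ne_0[OF assms] by (simp add: invertible_det_nz det_transpose)
  then obtain y where "?M *v y = x"
    by (metis invertible_right_inverse matrix_vector_mul_assoc matrix_vector_mul_lid)
  then have "x = y$3 *\<^sub>R w + y$1 *\<^sub>R u + y$2 *\<^sub>R v"
    by (simp add: matrix_vector_mult_vector_3 algebra_simps del: transpose_matrix_vector)
  then show ?thesis by (rule that)
qed

lemma ex_not_in_span_2:
  fixes u v :: "real^3"
  obtains w where "w \<notin> span {u, v}"
proof -
  have "dim (span {u, v}) \<le> card {u, v}"
    by (intro dim_le_card) auto
  also have "\<dots> \<le> 2"
    by (simp add: card_insert_if)
  finally have "dim (span {u, v}) < dim (UNIV :: (real^3) set)"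
    by simp
  then have "span {u, v} \<noteq> UNIV"
    by (metis less_irrefl)
  then show ?thesis using that by blast
qed

lemma subspace_fixed_space: "subspace (fixed_space H)"
  by (auto simp: fixed_space_def subspace_def matrix_vector_right_distrib matrix_vector_mult_scaleR)

lemma mem_fixed_space_singleton [simp]: "v \<in> fixed_space {A} \<longleftrightarrow> A *v v = v"
  by (simp add: fixed_space_def)

lemma matrix_sum_vec: "(\<Sum>i\<in>I. f i) *v x = (\<Sum>i\<in>I. f i *v x)" for f :: "'i \<Rightarrow> real^'n^'n"
  by (induction I rule: infinite_finite_induct) (auto simp: matrix_vector_mult_add_rdistrib)

section \<open>Finite matrix groups and their invariant inner product\<close>

locale finite_matrix_group =
  fixes G :: "(real^'n^'n) set"
  assumes finite_G: "finite G"
    and one_mem: "mat 1 \<in> G"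
    and mult_mem: "g \<in> G \<Longrightarrow> h \<in> G \<Longrightarrow> g ** h \<in> G"
    and inverse_mem: "g \<in> G \<Longrightarrow> matrix_inv g \<in> G"
    and invertible_mem: "g \<in> G \<Longrightarrow> invertible g"
begin

lemma left_inverse: "matrix_inv g ** g = mat 1"
  and right_inverse: "g ** matrix_inv g = mat 1" if "g \<in> G"
  using someI_ex[OF invertible_mem[OF that, unfolded invertible_def]]
  by (simp_all add: matrix_inv_def)

lemma inverse_vec [simp]: "g \<in> G \<Longrightarrow> matrix_inv g *v (g *v v) = v"
  and vec_inverse [simp]: "g \<in> G \<Longrightarrow> g *v (matrix_inv g *v v) = v"
  by (simp_all add: matrix_vector_mul_assoc left_inverse right_inverse)

lemma inj_vec: "g \<in> G \<Longrightarrow> g *v x = g *v y \<longleftrightarrow> x = y"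
  by (metis inverse_vec)

lemma right_translate:
  assumes "g \<in> G"
  shows "(\<lambda>h. h ** g) ` G = G"
proof (intro equalityI subsetI)
  fix h assume "h \<in> G"
  then show "h \<in> (\<lambda>h. h ** g) ` G"
    using assms mult_mem inverse_mem left_inverse
    by (intro image_eqI[of _ _ "h ** matrix_inv g"]) (simp_all flip: matrix_mul_assoc)
qed (use assms mult_mem in auto)

lemma inj_on_right_translate: "g \<in> G \<Longrightarrow> inj_on (\<lambda>h. h ** g) S"
  by (rule inj_on_inverseI[of _ "\<lambda>h. h ** matrix_inv g"])
    (simp add: right_inverse flip: matrix_mul_assoc)

lemma inj_on_left_translate: "g \<in> G \<Longrightarrow> inj_on (\<lambda>h. g ** h) S"
  by (rule inj_on_inverseI[of _ "\<lambda>h. matrix_inv g ** h"])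
    (simp add: left_inverse matrix_mul_assoc)

text \<open>The Gram matrix of the sum of the standard inner products pulled back along all elements
  of \<open>G\<close>.\<close>

definition invariant_form :: "real^'n^'n" where
  "invariant_form = (\<Sum>g\<in>G. transpose g ** g)"

lemma inner_invariant_form: "x \<bullet> (invariant_form *v y) = (\<Sum>g\<in>G. (g *v x) \<bullet> (g *v y))"
proof -
  have "x \<bullet> ((transpose g ** g) *v y) = (g *v x) \<bullet> (g *v y)" for g
  proof -
    have "x \<bullet> ((transpose g ** g) *v y) = x \<bullet> ((g *v y) v* g)"
      by (simp flip: matrix_vector_mul_assoc)
    also have "\<dots> = (g *v x) \<bullet> (g *v y)"
      by (metis dot_lmul_matrix inner_commute)
    finally show ?thesis .
  qed
  then show ?thesis
    unfolding invariant_form_def matrix_sum_vec inner_sum_right by (intro sum.cong refl)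
qed

text \<open>Right translation by \<open>A\<close> only permutes the summands of the form.\<close>

lemma inner_invariant:
  assumes "A \<in> G"
  shows "(A *v x) \<bullet> (invariant_form *v (A *v y)) = x \<bullet> (invariant_form *v y)"
proof -
  have "(\<Sum>g\<in>G. (g *v x) \<bullet> (g *v y)) = (\<Sum>g\<in>(\<lambda>h. h ** A) ` G. (g *v x) \<bullet> (g *v y))"
    using right_translate[OF assms] by simp
  also have "\<dots> = (\<Sum>g\<in>G. (g *v (A *v x)) \<bullet> (g *v (A *v y)))"
    by (subst sum.reindex[OF inj_on_right_translate[OF assms]]) (simp add: matrix_vector_mul_assoc)
  finally show ?thesis by (simp add: inner_invariant_form)
qed

lemma inner_invariant_form_pos: "x \<noteq> 0 \<Longrightarrow> x \<bullet> (invariant_form *v x) > 0"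
  unfolding inner_invariant_form
\<comment> \<open>The identity contributes \<open>x \<bullet> x\<close>, which is positive; the
  other summands are nonnegative.\<close>
proof (rule sum_pos2[OF finite_G one_mem])
qed auto

lemma det_invariant_form: "det invariant_form \<noteq> 0"
  by (metis det_eq_0_imp_kernel inner_invariant_form_pos inner_zero_right less_irrefl)

lemma invariant_form_congruence:
  assumes "A \<in> G"
  shows "transpose A ** invariant_form ** A = invariant_form"
proof -
  have "x \<bullet> ((transpose A ** invariant_form ** A) *v y) = x \<bullet> (invariant_form *v y)" for x y
  proof -
    have "x \<bullet> ((transpose A ** invariant_form ** A) *v y) = x \<bullet> ((invariant_form *v (A *v y)) v* A)"
      by (simp flip: matrix_vector_mul_assoc)
    also have "\<dots> = (A *v x) \<bullet> (invariant_form *v (A *v y))"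
      by (metis dot_lmul_matrix inner_commute)
    finally show ?thesis
      using inner_invariant[OF assms] by simp
  qed
  then show ?thesis
    by (metis matrix_eq vector_eq_ldot)
qed

text \<open>Applying \<open>A\<close> multiplies the positive number
  \<open>x \<bullet> (invariant_form *v x)\<close> by \<open>c * c\<close>, yet preserves
  it.\<close>

lemma eigenvalue_pm1:
  assumes "A \<in> G" "A *v x = c *\<^sub>R x" "x \<noteq> 0"
  shows "c = 1 \<or> c = -1"
proof -
  have "c * c * (x \<bullet> (invariant_form *v x)) = x \<bullet> (invariant_form *v x)"
    using inner_invariant[OF assms(1), of x x]
    by (simp add: assms(2) matrix_vector_mult_scaleR ac_simps)
  then have "c * c = 1"
    using inner_invariant_form_pos[OF assms(3)] by simp
  then show ?thesis
    using square_eq_1_iff by blast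
qed

lemma det_pm1:
  assumes "A \<in> G"
  shows "det A = 1 \<or> det A = -1"
proof -
  have "det A * det A * det invariant_form = det invariant_form"
    using arg_cong[OF invariant_form_congruence[OF assms], of det]
    by (simp add: det_mul det_transpose ac_simps)
  then show ?thesis
    using det_invariant_form square_eq_1_iff[of "det A"] by simp
qed

text \<open>\<open>A\<^sup>k w = w + k z\<close> takes finitely many values.\<close>
lemma unipotent_trivial:
  assumes A: "A \<in> G" and "A *v w = w + z" "A *v z = z"
  shows "z = 0"
proof (rule ccontr)
  assume "z \<noteq> 0"
  have "\<exists>g\<in>G. g *v w = w + real k *\<^sub>R z" for k
  proof (induction k)
    case 0
    then show ?case using one_mem by (auto intro!: bexI[of _ "mat 1"])
  next
    case (Suc k)
    then obtain g where g: "g \<in> G" "g *v w = w + real k *\<^sub>R z" by blast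
    then have "(A ** g) *v w = w + real (Suc k) *\<^sub>R z"
      using assms by (simp add: matrix_vector_right_distrib matrix_vector_mult_scaleR algebra_simps
          flip: matrix_vector_mul_assoc)
    then show ?case using g A mult_mem by blast
  qed
  then have "w + real k *\<^sub>R z \<in> (\<lambda>g. g *v w) ` G" for k
    by (metis imageI)
  then have "range (\<lambda>k. w + real k *\<^sub>R z) \<subseteq> (\<lambda>g. g *v w) ` G"
    by blast
  then have "finite (range (\<lambda>k. w + real k *\<^sub>R z))"
    using finite_G finite_surj by blast
  moreover have "inj (\<lambda>k. w + real k *\<^sub>R z)"
    using \<open>z \<noteq> 0\<close> by (auto intro: injI)
  ultimately show False
    using range_inj_infinite by blast
qed

end

subsection \<open>The axis of an element of determinant one\<close>

lemma mat_vector_mult: "mat c *v x = c *\<^sub>R x" for x :: "real^'n"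
  by (simp add: vec_eq_iff matrix_vector_mult_def mat_def if_distribR sum.delta' if_distrib[of "\<lambda>a. a * _"] cong: if_cong)

text \<open>If \<open>A\<close> preserves the form \<open>P\<close> and \<open>c = det A\<close>, then
  \<open>A\<^sup>T P (A - c) = -c (A - c)\<^sup>T P\<close>; in odd dimension the determinants of the two sides have opposite signs.\<close>
lemma ex_eigenvector_det:
  fixes A :: "real^3^3"
  assumes "finite_matrix_group G" and A: "A \<in> G"
  obtains u where "u \<noteq> 0" "A *v u = det A *\<^sub>R u"
proof -
  interpret finite_matrix_group G by fact
  let ?P = invariant_form
  define c where "c = det A"
  have cc: "c * c = 1"
    using det_pm1[OF A] by (auto simp: c_def)
  have P: "(?P *v (A *v x)) v* A = ?P *v x" for x
    using arg_cong[OF invariant_form_congruence[OF A], of "\<lambda>M. M *v x"]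
    by (simp flip: matrix_vector_mul_assoc)
  have tr: "transpose (A - mat c) = transpose A - mat c"
    by (simp add: vec_eq_iff transpose_def mat_def)
  have "transpose A ** ?P ** (A - mat c) = (- c) *\<^sub>R (transpose (A - mat c) ** ?P)"
  proof -
    have "(transpose A ** ?P ** (A - mat c)) *v x = ((- c) *\<^sub>R (transpose (A - mat c) ** ?P)) *v x" for x
    proof -
      have "(transpose A ** ?P ** (A - mat c)) *v x = transpose A *v (?P *v (A *v x - c *\<^sub>R x))"
        by (simp add: matrix_vector_mult_diff_rdistrib mat_vector_mult
            del: transpose_matrix_vector flip: matrix_vector_mul_assoc)
      also have "\<dots> = ?P *v x - c *\<^sub>R (transpose A *v (?P *v x))"
        using P by (simp add: matrix_vector_mult_diff_distrib matrix_vector_mult_scaleR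
            flip: transpose_matrix_vector)
      also have "\<dots> = (- c) *\<^sub>R (transpose A *v (?P *v x) - c *\<^sub>R (?P *v x))"
        using cc by (simp add: algebra_simps del: transpose_matrix_vector)
      also have "\<dots> = (- c) *\<^sub>R (transpose (A - mat c) *v (?P *v x))"
        unfolding tr by (simp add: matrix_vector_mult_diff_rdistrib mat_vector_mult del: transpose_matrix_vector)
      also have "\<dots> = ((- c) *\<^sub>R (transpose (A - mat c) ** ?P)) *v x"
        by (simp only: scaleR_matrix_vector_assoc matrix_vector_mul_assoc)
      finally show ?thesis .
    qed
    then show ?thesis by (simp add: matrix_eq)
  qed
  then have "c * det ?P * det (A - mat c) = det ((- c) *\<^sub>R (transpose (A - mat c) ** ?P))"
    by (metis c_def det_mul det_transpose)
  \<comment> \<open>The odd dimension enters here: the scalar factor comes out as its cube, which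
    \<open>c * c = 1\<close> reduces to \<open>- c\<close>. The left side carries the factor
    \<open>c\<close>, so both sides vanish.\<close>
  also have "\<dots> = - (c * c * c) * det (transpose (A - mat c) ** ?P)"
    by (simp add: det_3 algebra_simps)
  also have "\<dots> = - c * (det (A - mat c) * det ?P)"
    by (simp only: cc det_mul det_transpose mult_1)
  finally have "c * det ?P * det (A - mat c) = 0"
    by simp
  then have "det (A - mat c) = 0"
    using cc det_invariant_form by auto
  then obtain u where "u \<noteq> 0" "(A - mat c) *v u = 0"
    by (rule det_eq_0_imp_kernel)
  then show ?thesis
    using that[of u] by (simp add: matrix_vector_mult_diff_rdistrib mat_vector_mult c_def)
qed

text \<open>The eigenvector for the eigenvalue \<open>det A = 1\<close> spans the axis. With a
  further fixed vector outside its span, the determinant would make the last diagonal entry 1; then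
  \<open>A\<close> would be unipotent, hence trivial because \<open>G\<close> is finite.\<close>

lemma axis_of_det_1:
  fixes A :: "real^3^3"
  assumes G: "finite_matrix_group G" and A: "A \<in> G" "det A = 1" "A \<noteq> mat 1"
  shows "\<exists>u. u \<noteq> 0 \<and> fixed_space {A} = span {u}"
proof -
  interpret finite_matrix_group G by fact
  obtain u where "u \<noteq> 0" "A *v u = det A *\<^sub>R u"
    by (rule ex_eigenvector_det[OF G A(1)])
  then have u: "u \<noteq> 0" "A *v u = u"
    by (simp_all add: A(2))
  have "v \<in> span {u}" if v: "A *v v = v" for v
  proof (rule ccontr)
    assume nv: "v \<notin> span {u}"
    obtain w where w: "w \<notin> span {u, v}"
      by (rule ex_not_in_span_2)
    note basis = u(1) nv w
    obtain a b c where Aw: "A *v w = c *\<^sub>R w + a *\<^sub>R u + b *\<^sub>R v"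
      by (rule basis_expansion_3[OF basis])
    have "c = 1"
      using det_upper_triangular[OF basis _ _ Aw, of 1 1] u v A by simp
    \<comment> \<open>The displacement of \<open>w\<close> is a combination of fixed vectors, so it
      is itself fixed, as \<open>unipotent_trivial\<close> requires.\<close>
    moreover have "a *\<^sub>R u + b *\<^sub>R v = 0"
      using Aw \<open>c = 1\<close> u v
      by (intro unipotent_trivial[OF A(1), of w]) (simp_all add: matrix_vector_right_distrib matrix_vector_mult_scaleR)
    ultimately have "A *v w = w"
      using Aw by (simp add: add.assoc)
    have "A *v x = x" for x
    proof -
      obtain a b c where "x = c *\<^sub>R w + a *\<^sub>R u + b *\<^sub>R v"
        by (rule basis_expansion_3[OF basis])
      then show ?thesis
        using \<open>A *v w = w\<close> u v by (simp add: matrix_vector_right_distrib matrix_vector_mult_scaleR)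
    qed
    then show False
      using A(3) by (simp add: matrix_eq)
  qed
  moreover have "span {u} \<subseteq> fixed_space {A}"
    using u by (intro span_minimal subspace_fixed_space) simp
  ultimately show ?thesis
    using u by auto
qed

text \<open>If the determinant were -1, there would be an eigenvector \<open>u\<close> for -1
  besides a fixed vector \<open>v\<close>, and the third diagonal entry would be 1. Finiteness then
  yields a second fixed vector independent of \<open>v\<close>, but the fixed space is a
  line.\<close>

lemma det_of_codim_2:
  fixes A :: "real^3^3"
  assumes G: "finite_matrix_group G" and A: "A \<in> G" "codim (fixed_space {A}) = 2"
  shows "det A = 1"
proof (rule ccontr)
  interpret finite_matrix_group G by fact
  assume "det A \<noteq> 1"
  then have d: "det A = -1"
    using det_pm1 A by blast
  obtain u where "u \<noteq> 0" "A *v u = det A *\<^sub>R u"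
    by (rule ex_eigenvector_det[OF G A(1)])
  then have u: "u \<noteq> 0" "A *v u = - u"
    by (simp_all add: d)
  have dim1: "dim (fixed_space {A}) = 1"
    using A(2) by (simp add: codim_def)
  then have "\<not> fixed_space {A} \<subseteq> {0}"
    using dim_eq_0[of "fixed_space {A}"] by linarith
  then obtain v where "v \<in> fixed_space {A}" "v \<noteq> 0"
    by blast
  then have v: "v \<noteq> 0" "A *v v = v"
    by simp_all
  have nv: "v \<notin> span {u}"
  proof
    assume "v \<in> span {u}"
    then obtain k where "v = k *\<^sub>R u" by (auto simp: span_singleton)
    then have "A *v v = - v"
      using u by (simp add: matrix_vector_mult_scaleR)
    then have "v = - v"
      using v(2) by simp
    then have "v = 0"
      by (simp add: vec_eq_iff)
    with v(1) show False ..
  qed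
  obtain w where w: "w \<notin> span {u, v}"
    by (rule ex_not_in_span_2)
  note basis = u(1) nv w
  obtain a b c where Aw: "A *v w = c *\<^sub>R w + a *\<^sub>R u + b *\<^sub>R v"
    by (rule basis_expansion_3[OF basis])
  have "c = 1"
    using det_upper_triangular[OF basis _ _ Aw, of "-1" 1] u v d by simp
  then have Aw: "A *v w = w + a *\<^sub>R u + b *\<^sub>R v"
    using Aw by simp
  \<comment> \<open>Squaring cancels the \<open>u\<close> component, since \<open>A\<close> negates
    \<open>u\<close>, and doubles the \<open>v\<close> component. Hence \<open>A ** A\<close> moves
    \<open>w\<close> by a fixed vector and \<open>unipotent_trivial\<close> applies to it.\<close>
  have "(2 * b) *\<^sub>R v = 0"
  proof (rule unipotent_trivial[OF mult_mem[OF A(1) A(1)], of w])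
    have "A ** A *v w = A *v (A *v w)"
      by (simp add: matrix_vector_mul_assoc)
    also have "\<dots> = w + b *\<^sub>R v + b *\<^sub>R v"
      unfolding Aw by (simp add: Aw u v matrix_vector_right_distrib matrix_vector_mult_scaleR)
    also have "\<dots> = w + (2 * b) *\<^sub>R v"
      by (simp only: mult_2 scaleR_left_distrib add.assoc)
    finally show "A ** A *v w = w + (2 * b) *\<^sub>R v" .
    show "A ** A *v ((2 * b) *\<^sub>R v) = (2 * b) *\<^sub>R v"
      by (simp add: v(2) matrix_vector_mult_scaleR flip: matrix_vector_mul_assoc)
  qed
  then have "b = 0"
    using v by simp
  \<comment> \<open>\<open>A\<close> sends \<open>t u\<close> to \<open>- t u\<close> and adds
    \<open>a u\<close> to \<open>w\<close>, so the sum is fixed exactly when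
    \<open>t = a - t\<close>.\<close>
  define x where "x = w + (a / 2) *\<^sub>R u"
  have "A *v x = w + a *\<^sub>R u - (a / 2) *\<^sub>R u"
    using Aw u \<open>b = 0\<close> by (simp add: x_def matrix_vector_right_distrib matrix_vector_mult_scaleR)
  also have "\<dots> = x"
    by (simp add: x_def vec_eq_iff)
  finally have "A *v x = x" .
  have "x \<notin> span {v}"
  proof
    assume "x \<in> span {v}"
    then have "x \<in> span {u, v}"
      using span_mono[of "{v}" "{u, v}"] by blast
    moreover have "(a / 2) *\<^sub>R u \<in> span {u, v}"
      by (intro span_scale span_base) simp
    ultimately have "x - (a / 2) *\<^sub>R u \<in> span {u, v}"
      by (rule span_diff)
    then show False
      using w by (simp add: x_def)
  qed
  moreover from this have "x \<noteq> v"
    using span_base[of v "{v}"] by blast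
  ultimately have "independent {x, v}"
    using v by (simp add: independent_insert)
  have "{x, v} \<subseteq> fixed_space {A}"
    using v(2) \<open>A *v x = x\<close> by simp
  with \<open>independent {x, v}\<close> have "card {x, v} \<le> dim (fixed_space {A})"
    using independent_card_le_dim by blast
  then show False
    using \<open>x \<noteq> v\<close> dim1 by simp
qed

section \<open>The general linear group and the determinants of a generated group\<close>

lemma GL_simps [simp]:
  "carrier GL = {A. invertible A}" "x \<otimes>\<^bsub>GL\<^esub> y = x ** y" "\<one>\<^bsub>GL\<^esub> = mat 1"
  by (simp_all add: GL_def)

lemma group_GL: "group (GL :: (real^'n^'n) monoid)"
proof (rule groupI)
  fix A :: "real^'n^'n" assume "A \<in> carrier GL"
  then obtain B where "A ** B = mat 1" "B ** A = mat 1"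
    by (auto simp: invertible_def)
  then show "\<exists>B\<in>carrier GL. B \<otimes>\<^bsub>GL\<^esub> A = \<one>\<^bsub>GL\<^esub>"
    by (intro bexI[of _ B]) (auto simp: invertible_def)
qed (simp_all add: invertible_mult matrix_mul_assoc invertible_det_nz det_mul)

lemma m_inv_GL:
  fixes A :: "real^'n^'n"
  assumes "invertible A"
  shows "inv\<^bsub>GL\<^esub> A = matrix_inv A"
proof -
  have "A ** matrix_inv A = mat 1 \<and> matrix_inv A ** A = mat 1"
    using someI_ex[OF assms[unfolded invertible_def]] by (simp add: matrix_inv_def)
  then show ?thesis
    using assms by (intro group.inv_equality[OF group_GL]) (auto simp: invertible_def)
qed

lemma finite_matrix_group_if_subgroup:
  assumes "subgroup G GL" "finite G"
  shows "finite_matrix_group G"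
proof
  show inv: "invertible g" if "g \<in> G" for g
    using subgroup.subset[OF assms(1)] that by auto
  show "matrix_inv g \<in> G" if "g \<in> G" for g
    using subgroup.m_inv_closed[OF assms(1) that] m_inv_GL[OF inv[OF that]] by simp
  show "g ** h \<in> G" if "g \<in> G" "h \<in> G" for g h
    using subgroup.m_closed[OF assms(1) that] by simp
qed (use assms subgroup.one_closed[OF assms(1)] in auto)

lemma subgroup_det_1: "subgroup {A :: real^'n^'n. det A = 1} GL"
proof (rule group.subgroupI[OF group_GL])
  fix A :: "real^'n^'n" assume A: "A \<in> {A. det A = 1}"
  then have "invertible A"
    by (simp add: invertible_det_nz)
  then have "det (A ** matrix_inv A) = 1"
    using group.r_inv[OF group_GL, of A] by (simp add: m_inv_GL)
  then show "inv\<^bsub>GL\<^esub> A \<in> {A. det A = 1}"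
    using A \<open>invertible A\<close> by (simp add: det_mul m_inv_GL)
next
  have "mat 1 \<in> {A :: real^'n^'n. det A = 1}"
    by simp
  then show "{A :: real^'n^'n. det A = 1} \<noteq> {}"
    by (metis empty_iff)
  show "{A :: real^'n^'n. det A = 1} \<subseteq> carrier GL"
    by (auto simp: invertible_det_nz)
  show "A \<otimes>\<^bsub>GL\<^esub> B \<in> {A. det A = 1}" if "A \<in> {A. det A = 1}" "B \<in> {A. det A = 1}" for A B :: "real^'n^'n"
    using that by (simp add: det_mul)
qed

text \<open>The generators lie in the special linear group; being a subgroup, it contains everything
  that they generate.\<close>

lemma strictly_generated_codim2_det_1:
  fixes G :: "(real^3^3) set"
  assumes "subgroup G GL" "finite G" "strictly_generated_codim2 G" "g \<in> G"
  shows "det g = 1"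
proof -
  have "{g \<in> G. codim (fixed_space {g}) = 2} \<subseteq> {A. det A = 1}"
    using det_of_codim_2[OF finite_matrix_group_if_subgroup[OF assms(1,2)]] by auto
  then have "generate GL {g \<in> G. codim (fixed_space {g}) = 2} \<subseteq> {A. det A = 1}"
    using group.generate_subgroup_incl[OF group_GL _ subgroup_det_1] by blast
  then show ?thesis
    using assms(3,4) unfolding strictly_generated_codim2_def by auto
qed

subsection \<open>Luna strata\<close>

context finite_matrix_group
begin

lemma quot_map_eqI:
  assumes g: "g \<in> G"
  shows "quot_map G (g *v x) = quot_map G x"
proof -
  have "quot_map G x = (\<lambda>h. h *v x) ` ((\<lambda>h. h ** g) ` G)"
    by (simp add: quot_map_def right_translate[OF g])
  also have "\<dots> = quot_map G (g *v x)"
    by (simp add: quot_map_def image_image matrix_vector_mul_assoc)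
  finally show ?thesis ..
qed

lemma mem_quot_map: "x \<in> quot_map G x"
  unfolding quot_map_def using one_mem by (intro image_eqI[of _ _ "mat 1"]) simp_all

lemma quot_map_eq_iff: "quot_map G x = quot_map G y \<longleftrightarrow> (\<exists>g\<in>G. x = g *v y)"
proof
  assume "quot_map G x = quot_map G y"
  then have "x \<in> quot_map G y"
    using mem_quot_map by metis
  then show "\<exists>g\<in>G. x = g *v y"
    by (auto simp: quot_map_def)
qed (auto simp: quot_map_eqI)

lemma quot_map_vimage_image: "quot_map G -` (quot_map G ` S) = (\<Union>g\<in>G. (\<lambda>x. g *v x) ` S)"
proof (rule Set.set_eqI)
  fix x
  have "x \<in> quot_map G -` (quot_map G ` S) \<longleftrightarrow> (\<exists>y\<in>S. quot_map G x = quot_map G y)"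
    by (simp add: image_iff)
  also have "\<dots> \<longleftrightarrow> x \<in> (\<Union>g\<in>G. (\<lambda>x. g *v x) ` S)"
    unfolding quot_map_eq_iff by blast
  finally show "x \<in> quot_map G -` (quot_map G ` S) \<longleftrightarrow> x \<in> (\<Union>g\<in>G. (\<lambda>x. g *v x) ` S)" .
qed

text \<open>The preimage of the image of \<open>S\<close> is a finite union of translates of
  \<open>S\<close>, each closed as an injective linear image. So the quotient map is closed.\<close>

lemma closedin_quot_map_image:
  assumes "closed S"
  shows "closedin (quot_space G) (quot_map G ` S)"
proof -
  have "closed (quot_map G -` (quot_map G ` S))"
    unfolding quot_map_vimage_image
  proof (intro closed_UN finite_G ballI)
    fix g assume g: "g \<in> G"
    show "closed ((\<lambda>x. g *v x) ` S)"
      by (rule closed_injective_linear_image[OF assms]) (simp_all add: inj_def inj_vec[OF g])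
  qed
  moreover have "quot_map G ` S \<subseteq> topspace (quot_space G)"
    by (auto simp: topspace_quot_space)
  ultimately show ?thesis
    using quotient_map_quot_map[of G] unfolding quotient_map_closedin
    by (simp add: vimage_def)
qed

text \<open>One inclusion is closedness of the quotient map, the other its continuity. Closures of
  strata can thus be computed in the vector space.\<close>

lemma closure_of_quot_map_image:
  "quot_space G closure_of (quot_map G ` S) = quot_map G ` closure S"
proof
  show "quot_space G closure_of (quot_map G ` S) \<subseteq> quot_map G ` closure S"
    by (intro closure_of_minimal closedin_quot_map_image closed_closure image_mono closure_subset)
  show "quot_map G ` closure S \<subseteq> quot_space G closure_of (quot_map G ` S)"
    using continuous_map_image_closure_subset[OF quotient_imp_continuous_map[OF quotient_map_quot_map], of G S]
    by simp
qed

lemma stab_translate: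
  assumes g: "g \<in> G"
  shows "stab G (g *v v) = (\<lambda>h. g ** h ** matrix_inv g) ` stab G v"
proof (intro equalityI subsetI)
  fix k assume k: "k \<in> stab G (g *v v)"
  let ?h = "matrix_inv g ** k ** g"
  have "k = g ** ?h ** matrix_inv g"
    using g left_inverse right_inverse by (simp add: matrix_mul_assoc) (simp flip: matrix_mul_assoc)
  moreover have "?h \<in> stab G v"
    using k g mult_mem inverse_mem by (simp add: stab_def flip: matrix_vector_mul_assoc)
  ultimately show "k \<in> (\<lambda>h. g ** h ** matrix_inv g) ` stab G v"
    by (rule image_eqI)
next
  fix k assume "k \<in> (\<lambda>h. g ** h ** matrix_inv g) ` stab G v"
  then show "k \<in> stab G (g *v v)"
    using g mult_mem inverse_mem by (auto simp: stab_def simp flip: matrix_vector_mul_assoc)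
qed

lemma stab_translate_eq:
  assumes "g \<in> G" "stab G v = stab G w"
  shows "stab G (g *v v) = stab G (g *v w)"
  by (simp add: stab_translate assms)

text \<open>Moving a vector within its orbit conjugates its stabilizer, so every orbit in the
  stratum has a representative with stabilizer exactly \<open>stab G v\<close>. A single stabilizer
  can therefore replace the conjugacy class.\<close>

lemma luna_stratum_stab:
  "luna_stratum G (conj_class G (stab G v)) = quot_map G ` {w. stab G w = stab G v}"
proof (intro equalityI subsetI)
  fix x assume "x \<in> luna_stratum G (conj_class G (stab G v))"
  then obtain w g where w: "x = quot_map G w" "g \<in> G" "stab G w = stab G (g *v v)"
    by (auto simp: luna_stratum_def conj_class_def stab_translate)
  then have "stab G (matrix_inv g *v w) = stab G v"
    using stab_translate_eq[OF inverse_mem w(3)] by simp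
  moreover have "x = quot_map G (matrix_inv g *v w)"
    using w quot_map_eqI[OF inverse_mem] by simp
  ultimately show "x \<in> quot_map G ` {w. stab G w = stab G v}"
    by blast
next
  fix x assume "x \<in> quot_map G ` {w. stab G w = stab G v}"
  then obtain w where "x = quot_map G w" "stab G w = stab G (mat 1 *v v)"
    by auto
  then show "x \<in> luna_stratum G (conj_class G (stab G v))"
    using one_mem unfolding luna_stratum_def conj_class_def stab_translate[OF one_mem] by blast
qed

lemma luna_closures_eq:
  "luna_closures G = range (\<lambda>v. quot_map G ` closure {w. stab G w = stab G v})"
proof -
  have "luna_closures G = range (\<lambda>v. quot_space G closure_of luna_stratum G (conj_class G (stab G v)))"
    unfolding luna_closures_def stabilizer_classes_def by blast
  then show ?thesis
    by (simp add: luna_stratum_stab closure_of_quot_map_image)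
qed

end

section \<open>Closures of strata when every nontrivial element has an axis\<close>

lemma closure_span_singleton_minus_0:
  fixes v :: "'a::euclidean_space"
  assumes "v \<noteq> 0"
  shows "closure (span {v} - {0}) = span {v}"
proof (intro equalityI subsetI)
  fix w assume w: "w \<in> span {v}"
  show "w \<in> closure (span {v} - {0})"
  proof (cases "w = 0")
    case True
    \<comment> \<open>\<open>Suc\<close> keeps the sequence off the origin: \<open>inverse 0\<close>
      is 0, so index 0 would otherwise give the excluded vector.\<close>
    have "(\<lambda>n. inverse (real (Suc n)) *\<^sub>R v) \<longlonglongrightarrow> 0 *\<^sub>R v"
      by (intro tendsto_scaleR LIMSEQ_inverse_real_of_nat tendsto_const)
    moreover have "inverse (real (Suc n)) *\<^sub>R v \<in> span {v} - {0}" for n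
      using assms span_scale[OF span_base[of v "{v}"]] by simp
    ultimately show ?thesis
      unfolding True closure_sequential
      by (intro exI[of _ "\<lambda>n. inverse (real (Suc n)) *\<^sub>R v"]) simp
  next
    case False
    then show ?thesis
      using w by (intro closure_subset[THEN subsetD]) simp
  qed
next
  have "closure (span {v} - {0}) \<subseteq> span {v}"
    by (rule closure_minimal[OF Diff_subset closed_span])
  then show "w \<in> span {v}" if "w \<in> closure (span {v} - {0})" for w
    using that by (rule subsetD)
qed

text \<open>The condition on \<open>fixed_space G\<close> excludes groups such as cyclic rotation
  groups, where all elements share one axis and the origin has the same stabilizer as the rest of
  that axis.\<close>

locale axial_matrix_group = finite_matrix_group G for G :: "(real^3^3) set" +
  assumes axis: "g \<in> G \<Longrightarrow> g \<noteq> mat 1 \<Longrightarrow> \<exists>u. u \<noteq> 0 \<and> fixed_space {g} = span {u}"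
    and fixed_space_G: "fixed_space G = {0}"
begin

lemma axis_through:
  assumes "g \<in> G" "g \<noteq> mat 1" "g *v v = v" "v \<noteq> 0"
  shows "fixed_space {g} = span {v}"
proof -
  obtain u where u: "u \<noteq> 0" "fixed_space {g} = span {u}"
    using axis[OF assms(1,2)] by blast
  moreover have "v \<in> fixed_space {g}"
    using assms(3) by simp
  ultimately obtain c where c: "v = c *\<^sub>R u"
    by (auto simp: span_singleton)
  with assms(4) have "c \<noteq> 0"
    by auto
  then have "u = inverse c *\<^sub>R v"
    using c by simp
  then have "u \<in> span {v}"
    using span_scale[OF span_base[of v "{v}"]] by simp
  then have "span {u} \<subseteq> span {v}"
    by (intro span_minimal) auto
  moreover have "span {v} \<subseteq> span {u}"
    using \<open>v \<in> fixed_space {g}\<close> u(2) by (intro span_minimal) auto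
  ultimately show ?thesis
    using u by blast
qed

lemma stab_0: "stab G 0 = G"
  by (simp add: stab_def)

lemma stab_eq_G_iff: "stab G v = G \<longleftrightarrow> v = 0"
  using fixed_space_G by (auto simp: stab_def fixed_space_def)

text \<open>The complement is a finite union of lines in dimension three, hence negligible, hence
  without interior.\<close>

lemma closure_trivial_stab: "closure {w. stab G w = {mat 1}} = UNIV"
proof -
  let ?L = "\<Union>g\<in>G - {mat 1}. fixed_space {g}"
  have "stab G w = {mat 1} \<longleftrightarrow> w \<notin> ?L" for w
    using one_mem by (auto simp: stab_def)
  then have "{w. stab G w = {mat 1}} = - ?L"
    by blast
  moreover have "negligible ?L"
  proof (rule negligible_Union[of "(\<lambda>g. fixed_space {g}) ` (G - {mat 1})"])
    fix T assume "T \<in> (\<lambda>g. fixed_space {g}) ` (G - {mat 1})"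
    then obtain u :: "real^3" where "u \<noteq> 0" "T = span {u}"
      using axis by blast
    then show "negligible T"
      by (intro negligible_lowdim) simp
  qed (use finite_G in auto)
  then have "interior ?L = {}"
    by (meson negligible_subset interior_subset open_interior open_not_negligible)
  ultimately show ?thesis
    by (simp only: closure_complement Compl_empty_eq)
qed

text \<open>A vector with the stabilizer of \<open>v\<close> is fixed by \<open>g\<close>, so it
  lies on the axis; conversely, nonzero scaling keeps the stabilizer. Only the origin, whose
  stabilizer is all of \<open>G\<close>, is missing, and the closure restores it.\<close>

lemma closure_axis_stab:
  assumes g: "g \<in> G" "g \<noteq> mat 1" "g *v v = v" and "v \<noteq> 0"
  shows "closure {w. stab G w = stab G v} = fixed_space {g}"
proof -
  have "{w. stab G w = stab G v} = span {v} - {0}"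
  proof (intro equalityI subsetI)
    fix w assume w: "w \<in> {w. stab G w = stab G v}"
    then have "g \<in> stab G w"
      using g by (simp add: stab_def)
    then have "w \<in> fixed_space {g}"
      by (simp add: stab_def)
    moreover have "w \<noteq> 0"
      using w stab_0 stab_eq_G_iff[of v] \<open>v \<noteq> 0\<close> by (metis mem_Collect_eq)
    ultimately show "w \<in> span {v} - {0}"
      using axis_through[OF assms] by blast
  next
    fix w assume "w \<in> span {v} - {0}"
    then obtain c where "w = c *\<^sub>R v" "c \<noteq> 0"
      by (auto simp: span_singleton)
    then show "w \<in> {w. stab G w = stab G v}"
      by (simp add: stab_def matrix_vector_mult_scaleR)
  qed
  then show ?thesis
    using closure_span_singleton_minus_0 axis_through assms by simp
qed

text \<open>Two axes have the same image in the quotient exactly when they lie in one orbit, so the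
  elements of this set stand for the orbits of axes.\<close>

definition axis_classes :: "(real^3) set set set" where
  "axis_classes = (\<lambda>g. quot_map G ` fixed_space {g}) ` (G - {mat 1})"

text \<open>A vector is the origin, has trivial stabilizer, or is a nonzero vector on an axis; these
  cases give the three kinds of closures.\<close>

lemma luna_closures_axial:
  "luna_closures G = insert (range (quot_map G)) (insert {quot_map G 0} axis_classes)"
proof (intro equalityI subsetI)
  fix C assume "C \<in> luna_closures G"
  then obtain v where C: "C = quot_map G ` closure {w. stab G w = stab G v}"
    by (auto simp: luna_closures_eq)
  consider "v = 0" | "stab G v = {mat 1}" | g where "v \<noteq> 0" "g \<in> G" "g \<noteq> mat 1" "g *v v = v"
  proof (cases "v = 0 \<or> stab G v = {mat 1}")
    case False
    moreover have "mat 1 \<in> stab G v"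
      using one_mem by (simp add: stab_def)
    ultimately obtain g where "g \<in> stab G v" "g \<noteq> mat 1"
      by blast
    then show ?thesis
      using False by (intro that(3)[of g]) (simp_all add: stab_def)
  qed (use that in blast)
  then show "C \<in> insert (range (quot_map G)) (insert {quot_map G 0} axis_classes)"
  proof cases
    case 1
    then show ?thesis using C by (simp add: stab_0 stab_eq_G_iff)
  next
    case 2
    then show ?thesis using C by (simp add: closure_trivial_stab)
  next
    case 3
    then have "C = quot_map G ` fixed_space {g}"
      using C closure_axis_stab by simp
    then show ?thesis
      using 3 by (simp add: axis_classes_def)
  qed
next
  fix C assume "C \<in> insert (range (quot_map G)) (insert {quot_map G 0} axis_classes)"
  then consider "C = range (quot_map G)" | "C = {quot_map G 0}"
    | g where "g \<in> G" "g \<noteq> mat 1" "C = quot_map G ` fixed_space {g}"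
    by (auto simp: axis_classes_def)
  then have "\<exists>v. C = quot_map G ` closure {w. stab G w = stab G v}"
  proof cases
    case 1
    \<comment> \<open>Density supplies a representative: the empty set is not dense.\<close>
    have "{w. stab G w = {mat 1}} \<noteq> {}"
    proof
      assume "{w. stab G w = {mat 1}} = {}"
      from this closure_trivial_stab have "closure ({} :: (real^3) set) = UNIV"
        by (rule subst)
      then show False
        by simp
    qed
    then obtain v where "stab G v = {mat 1}"
      by blast
    then show ?thesis
      using closure_trivial_stab 1 by (intro exI[of _ v]) simp
  next
    case 2
    then show ?thesis
      by (intro exI[of _ 0]) (simp add: stab_0 stab_eq_G_iff)
  next
    case 3
    then obtain u where u: "u \<noteq> 0" "fixed_space {g} = span {u}"
      using axis by blast
    then have "u \<in> fixed_space {g}"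
      using span_base[of u "{u}"] by simp
    then have "g *v u = u"
      by simp
    then show ?thesis
      using closure_axis_stab[OF 3(1,2) _ u(1)] 3(3) by (intro exI[of _ u]) simp
  qed
  then show "C \<in> luna_closures G"
    by (auto simp: luna_closures_eq)
qed

end

subsection \<open>Counting the orbits of axes\<close>

context axial_matrix_group
begin

lemma quot_map_eq_0_iff: "quot_map G v = quot_map G 0 \<longleftrightarrow> v = 0"
proof -
  have "quot_map G v = quot_map G 0 \<longleftrightarrow> (\<exists>g\<in>G. v = g *v 0)"
    by (rule quot_map_eq_iff)
  also have "\<dots> \<longleftrightarrow> v = 0"
    using one_mem by auto
  finally show ?thesis .
qed

lemma quot_map_span_translate:
  assumes h: "h \<in> G"
  shows "quot_map G ` span {h *v u} = quot_map G ` span {u}"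
proof -
  have "quot_map G (c *\<^sub>R (h *v u)) = quot_map G (c *\<^sub>R u)" for c
    using quot_map_eqI[OF h, of "c *\<^sub>R u"] by (simp add: matrix_vector_mult_scaleR)
  then show ?thesis
    by (simp add: span_singleton image_image)
qed

lemma axis_classE:
  assumes "C \<in> axis_classes"
  obtains g u where "g \<in> G" "g \<noteq> mat 1" "u \<noteq> 0" "g *v u = u" "fixed_space {g} = span {u}"
    "C = quot_map G ` span {u}"
proof -
  obtain g where g: "g \<in> G" "g \<noteq> mat 1" "C = quot_map G ` fixed_space {g}"
    using assms by (auto simp: axis_classes_def)
  then obtain u where u: "u \<noteq> 0" "fixed_space {g} = span {u}"
    using axis by blast
  then have "u \<in> fixed_space {g}"
    using span_base[of u "{u}"] by simp
  then have "g *v u = u"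
    by simp
  then show ?thesis
    using that[of g u] g u by simp
qed

text \<open>A lift of the given orbit to the axis is nonzero and so spans it; translating to
  \<open>v\<close> keeps the image. Hence two classes sharing an orbit other than that of 0
  coincide.\<close>

lemma axis_class_eq:
  assumes "C \<in> axis_classes" "quot_map G v \<in> C" "v \<noteq> 0"
  shows "C = quot_map G ` span {v}"
proof -
  obtain g u where g: "g \<in> G" "g \<noteq> mat 1" "u \<noteq> 0" "g *v u = u" "fixed_space {g} = span {u}"
    "C = quot_map G ` span {u}"
    by (rule axis_classE[OF assms(1)])
  then obtain w where w: "w \<in> fixed_space {g}" "quot_map G v = quot_map G w"
    using assms(2) by auto
  then have gw: "g *v w = w"
    by simp
  obtain h where h: "h \<in> G" "v = h *v w"
    using w(2) quot_map_eq_iff by auto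
  then have "w \<noteq> 0"
    using assms(3) by auto
  then have "fixed_space {g} = span {w}"
    by (rule axis_through[OF g(1,2) gw])
  then show ?thesis
    using g h quot_map_span_translate by simp
qed

lemma zero_psubset_axis_class:
  assumes "C \<in> axis_classes"
  shows "{quot_map G 0} \<subset> C"
proof -
  obtain u where "u \<noteq> 0" and C: "C = quot_map G ` span {u}"
    using assms by (rule axis_classE)
  moreover have "quot_map G u \<in> C" "quot_map G 0 \<in> C"
    unfolding C by (intro imageI span_base span_zero; simp)+
  ultimately show ?thesis
    using quot_map_eq_0_iff[of u] by blast
qed

text \<open>The orbit of a vector with trivial stabilizer stays outside: stabilizers along an orbit
  are conjugate, while vectors on an axis are fixed by a nontrivial element.\<close>

lemma axis_class_psubset:
  assumes "C \<in> axis_classes"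
  shows "C \<subset> range (quot_map G)"
proof -
  obtain g where g: "g \<in> G" "g \<noteq> mat 1" and C: "C = quot_map G ` fixed_space {g}"
    using assms by (auto simp: axis_classes_def)
  have "{w. stab G w = {mat 1}} \<noteq> {}"
    using closure_trivial_stab by (metis UNIV_I closure_empty empty_iff)
  then obtain v where v: "stab G v = {mat 1}"
    by blast
  have "quot_map G v \<notin> C"
  proof
    assume "quot_map G v \<in> C"
    then obtain w where w: "g *v w = w" "quot_map G w = quot_map G v"
      using C by auto
    then obtain h where h: "h \<in> G" "w = h *v v"
      using quot_map_eq_iff by auto
    then have "stab G w = {mat 1}"
      using v right_inverse by (simp add: stab_translate)
    moreover have "g \<in> stab G w"
      using g w by (simp add: stab_def)
    ultimately show False
      using g by simp
  qed
  then show ?thesis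
    using C by blast
qed

lemma axis_class_Int:
  assumes "C \<in> axis_classes" "D \<in> axis_classes" "C \<noteq> D"
  shows "C \<inter> D = {quot_map G 0}"
proof -
  have "x = quot_map G 0" if "x \<in> C" "x \<in> D" for x
  proof (rule ccontr)
    assume x: "x \<noteq> quot_map G 0"
    obtain v where v: "x = quot_map G v"
      using axis_class_psubset[OF assms(1)] \<open>x \<in> C\<close> by blast
    then have "v \<noteq> 0"
      using x by auto
    then show False
      using axis_class_eq[of C v] axis_class_eq[of D v] assms that v by simp
  qed
  moreover have "quot_map G 0 \<in> C" "quot_map G 0 \<in> D"
    using zero_psubset_axis_class assms by blast+
  ultimately show ?thesis
    by blast
qed

lemma finite_axis_classes: "finite axis_classes"
  using finite_G by (simp add: axis_classes_def)

text \<open>For \<open>u \<noteq> 0\<close> this is the setwise stabilizer of the line through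
  \<open>u\<close>, since by \<open>eigenvalue_pm1\<close> elements of \<open>G\<close> can rescale
  \<open>u\<close> only by 1 or -1.\<close>

definition line_stab :: "real^3 \<Rightarrow> (real^3^3) set" where
  "line_stab u = {h \<in> G. h *v u = u \<or> h *v u = - u}"

lemma finite_stab: "finite (stab G v)"
  using finite_G by (simp add: stab_def)

lemma finite_line_stab: "finite (line_stab u)"
  using finite_G by (simp add: line_stab_def)

lemma card_stab_le_line_stab: "card (stab G u) \<le> card (line_stab u)"
  by (rule card_mono[OF finite_line_stab]) (auto simp: stab_def line_stab_def)

text \<open>Left multiplication by one element that reverses \<open>u\<close> embeds all such
  elements into the stabilizer.\<close>

lemma card_line_stab_le: "card (line_stab u) \<le> 2 * card (stab G u)"
proof -
  let ?F = "{h \<in> G. h *v u = - u}"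
  have "card ?F \<le> card (stab G u)"
  proof (cases "?F = {}")
    case False
    then obtain h where h: "h \<in> G" "h *v u = - u"
      by blast
    have "(\<lambda>k. h ** k) ` ?F \<subseteq> stab G u"
    proof (rule image_subsetI)
      fix k assume k: "k \<in> ?F"
      then have "h *v (k *v u) = u"
        using h matrix_vector_mult_scaleR[of h "-1" u] by simp
      then show "h ** k \<in> stab G u"
        using h k mult_mem by (simp add: stab_def matrix_vector_mul_assoc)
    qed
    then have "card ((\<lambda>k. h ** k) ` ?F) \<le> card (stab G u)"
      by (rule card_mono[OF finite_stab])
    then show ?thesis
      by (simp only: card_image[OF inj_on_left_translate[OF h(1)]])
  next
    case True
    then show ?thesis
      by (simp only: card.empty)
  qed
  then have "card (stab G u \<union> ?F) \<le> 2 * card (stab G u)"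
    using card_Un_le[of "stab G u" ?F] by linarith
  moreover have "line_stab u = stab G u \<union> ?F"
    by (auto simp: line_stab_def stab_def)
  ultimately show ?thesis
    by simp
qed

lemma card_stab_translate:
  assumes h: "h \<in> G"
  shows "card (stab G (h *v u)) = card (stab G u)"
proof -
  have "inj_on (\<lambda>k. h ** k ** matrix_inv h) (stab G u)"
  proof (rule inj_on_inverseI[of _ "\<lambda>k. matrix_inv h ** k ** h"])
    fix k
    have "matrix_inv h ** (h ** k ** matrix_inv h) ** h = (matrix_inv h ** h) ** k ** (matrix_inv h ** h)"
      by (simp only: matrix_mul_assoc)
    then show "matrix_inv h ** (h ** k ** matrix_inv h) ** h = k"
      by (simp add: left_inverse[OF h])
  qed
  then show ?thesis
    by (simp add: stab_translate[OF h] card_image)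
qed

text \<open>The elements carrying \<open>u\<close> onto the axis of \<open>g\<close> form the coset
  \<open>h ** l\<close> with \<open>l\<close> in \<open>line_stab u\<close>: if \<open>k\<close> is
  one of them, \<open>matrix_inv h ** k\<close> rescales \<open>u\<close>, hence by 1 or -1.\<close>

lemma card_transporter:
  assumes g: "g \<in> G" "g \<noteq> mat 1" and h: "h \<in> G" "g *v (h *v u) = h *v u" and "u \<noteq> 0"
  shows "card {k \<in> G. g *v (k *v u) = k *v u} = card (line_stab u)"
proof -
  have "h *v u \<noteq> 0"
    using \<open>u \<noteq> 0\<close> inverse_vec[OF h(1), of u] by auto
  then have fix_g: "fixed_space {g} = span {h *v u}"
    using axis_through g h by simp
  have "{k \<in> G. g *v (k *v u) = k *v u} = (\<lambda>k. h ** k) ` line_stab u"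
  proof (intro equalityI subsetI)
    fix k assume k: "k \<in> {k \<in> G. g *v (k *v u) = k *v u}"
    then have "k *v u \<in> span {h *v u}"
      using fix_g by (metis (lifting) mem_Collect_eq mem_fixed_space_singleton)
    then obtain c where c: "k *v u = c *\<^sub>R (h *v u)"
      by (auto simp: span_singleton)
    let ?l = "matrix_inv h ** k"
    have l: "?l \<in> G"
      using k h mult_mem inverse_mem by simp
    have "?l *v u = matrix_inv h *v (k *v u)"
      by (simp add: matrix_vector_mul_assoc)
    also have "\<dots> = c *\<^sub>R u"
      unfolding c by (simp add: matrix_vector_mult_scaleR h)
    finally have lu: "?l *v u = c *\<^sub>R u" .
    then have "c = 1 \<or> c = -1"
      using eigenvalue_pm1[OF l _ \<open>u \<noteq> 0\<close>] by simp
    then have "?l \<in> line_stab u"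
      using l lu unfolding line_stab_def by force
    moreover have "k = h ** ?l"
      by (simp add: matrix_mul_assoc right_inverse[OF h(1)])
    ultimately show "k \<in> (\<lambda>k. h ** k) ` line_stab u"
      by (rule rev_image_eqI)
  next
    fix k assume "k \<in> (\<lambda>k. h ** k) ` line_stab u"
    then obtain l where l: "l \<in> G" "l *v u = u \<or> l *v u = - u" "k = h ** l"
      by (auto simp: line_stab_def)
    have "k *v u = h *v (l *v u)"
      by (simp add: l(3) matrix_vector_mul_assoc)
    then have "k *v u = h *v u \<or> k *v u = - (h *v u)"
      using l(2) matrix_vector_mult_scaleR[of h "-1" u] by auto
    then have "g *v (k *v u) = k *v u"
      using h(2) matrix_vector_mult_scaleR[of g "-1" "h *v u"] by auto
    then show "k \<in> {k \<in> G. g *v (k *v u) = k *v u}"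
      using l h mult_mem by simp
  qed
  then show ?thesis
    by (simp add: card_image[OF inj_on_left_translate[OF h(1)]])
qed

text \<open>As \<open>C\<close> runs through \<open>axis_classes\<close>, these sets partition the
  nontrivial elements of \<open>G\<close> by the orbit of their axis.\<close>

definition axis_fiber :: "(real^3) set set \<Rightarrow> (real^3^3) set" where
  "axis_fiber C = {g \<in> G - {mat 1}. quot_map G ` fixed_space {g} = C}"

text \<open>Double counting of the pairs \<open>(h, g)\<close> such that \<open>g \<noteq> 1\<close> fixes \<open>h u\<close>.\<close>
lemma card_axis_fiber:
  assumes u: "u \<noteq> 0"
  shows "card (line_stab u) * card (axis_fiber (quot_map G ` span {u})) = card G * (card (stab G u) - 1)"
proof -
  let ?T = "axis_fiber (quot_map G ` span {u})"
  let ?R = "\<lambda>h g. g *v (h *v u) = h *v u"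
  \<comment> \<open>Count with \<open>g\<close> fixed: the axis of \<open>g\<close> and the line of
    \<open>u\<close> have the same image, so some \<open>h\<close> carries \<open>u\<close> onto the
    axis, and \<open>card_transporter\<close> counts all of them.\<close>
  have "card {h \<in> G. ?R h g} = card (line_stab u)" if "g \<in> ?T" for g
  proof -
    have g: "g \<in> G" "g \<noteq> mat 1" "quot_map G ` fixed_space {g} = quot_map G ` span {u}"
      using that by (auto simp: axis_fiber_def)
    have "quot_map G u \<in> quot_map G ` fixed_space {g}"
      unfolding g(3) by (intro imageI span_base) simp
    then obtain w where w: "g *v w = w" "quot_map G w = quot_map G u"
      by auto
    then obtain h where "h \<in> G" "w = h *v u"
      using quot_map_eq_iff by auto
    then show ?thesis
      using card_transporter g w u by simp
  qed
  \<comment> \<open>Count with \<open>h\<close> fixed: every nontrivial element of the stabilizer of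
    \<open>h *v u\<close> has its axis in the right orbit, and that stabilizer is conjugate to
    \<open>stab G u\<close>.\<close>
  moreover have "card {g \<in> ?T. ?R h g} = card (stab G u) - 1" if h: "h \<in> G" for h
  proof -
    have "h *v u \<noteq> 0"
      using u inverse_vec[OF h, of u] by auto
    have "{g \<in> ?T. ?R h g} = stab G (h *v u) - {mat 1}"
    proof (intro equalityI subsetI)
      fix g assume "g \<in> stab G (h *v u) - {mat 1}"
      then have g: "g \<in> G" "g \<noteq> mat 1" "?R h g"
        by (auto simp: stab_def)
      then have "fixed_space {g} = span {h *v u}"
        using axis_through \<open>h *v u \<noteq> 0\<close> by simp
      then show "g \<in> {g \<in> ?T. ?R h g}"
        using g quot_map_span_translate[OF h] by (simp add: axis_fiber_def)
    qed (auto simp: axis_fiber_def stab_def)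
    moreover have "mat 1 \<in> stab G (h *v u)"
      using one_mem by (simp add: stab_def)
    ultimately show ?thesis
      using card_stab_translate[OF h] by simp
  qed
  ultimately show ?thesis
    using sum_multicount[of G ?T ?R "card (line_stab u)"] finite_G
    by (simp add: axis_fiber_def)
qed

lemma card_axis_fiber_bounds:
  assumes "C \<in> axis_classes"
  shows "card G \<le> 4 * card (axis_fiber C)" "card (axis_fiber C) \<noteq> card G - 1"
proof -
  obtain g u where gu: "g \<in> G" "g \<noteq> mat 1" "u \<noteq> 0" "g *v u = u" "C = quot_map G ` span {u}"
    using assms by (rule axis_classE)
  let ?m = "card (stab G u)" and ?s = "card (line_stab u)" and ?c = "card (axis_fiber C)" and ?N = "card G"
  have eq: "?s * ?c = ?N * (?m - 1)"
    using card_axis_fiber gu by simp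
  have "card {mat 1, g} \<le> ?m"
    using gu one_mem by (intro card_mono finite_stab) (simp add: stab_def)
  then have m2: "2 \<le> ?m"
    using gu(2) by simp
  \<comment> \<open>The constant 4 arises from \<open>?s \<le> 2 * ?m\<close> and
    \<open>2 * ?m \<le> 4 * (?m - 1)\<close>, the latter because \<open>?m \<ge> 2\<close>.\<close>
  have "?s * ?N \<le> (4 * (?m - 1)) * ?N"
    using card_line_stab_le[of u] m2 by (intro mult_right_mono) linarith+
  also have "\<dots> = ?s * (4 * ?c)"
    using eq by (simp add: algebra_simps)
  finally have "?s * ?N \<le> ?s * (4 * ?c)" .
  moreover have "0 < ?s"
    using card_stab_le_line_stab[of u] m2 by linarith
  ultimately show "?N \<le> 4 * ?c"
    by simp
  show "?c \<noteq> ?N - 1"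
  proof
    assume "?c = ?N - 1"
    \<comment> \<open>This uses \<open>?m \<le> ?s\<close>. Cancelling \<open>?m * ?N\<close> leaves
      \<open>?N \<le> ?m\<close>, so \<open>u\<close> is fixed by all of \<open>G\<close>.\<close>
    then have "?m * (?N - 1) \<le> ?N * (?m - 1)"
      using eq mult_right_mono[OF card_stab_le_line_stab[of u], of ?c] by simp
    moreover have "?m \<le> ?N"
      by (rule card_mono[OF finite_G]) (simp add: stab_def)
    ultimately have "?N \<le> ?m"
      using m2 by (cases ?m; cases ?N) simp_all
    then have "stab G u = G"
      by (intro card_seteq finite_G) (simp_all add: stab_def)
    then show False
      using stab_eq_G_iff gu by simp
  qed
qed

lemma card_axis_classes: "card axis_classes \<in> {2, 3}"
proof -
  have N: "card G \<ge> 1"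
    using one_mem finite_G by (metis Suc_leI card_gt_0_iff empty_iff One_nat_def)
  \<comment> \<open>Summing the constant 1 along the fibers of the map from an element to its axis
    class counts the nontrivial elements.\<close>
  have "card (G - {mat 1}) = (\<Sum>C\<in>axis_classes. card (axis_fiber C))"
    using sum.image_gen[of "G - {mat 1}" "\<lambda>_. 1 :: nat" "\<lambda>g. quot_map G ` fixed_space {g}"] finite_G
    by (simp add: axis_classes_def axis_fiber_def)
  then have total: "(\<Sum>C\<in>axis_classes. card (axis_fiber C)) = card G - 1"
    using one_mem by simp
  have "card axis_classes * card G \<le> (\<Sum>C\<in>axis_classes. 4 * card (axis_fiber C))"
    using sum_bounded_below[of axis_classes "card G" "\<lambda>C. 4 * card (axis_fiber C)"] card_axis_fiber_bounds(1)
    by simp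
  also have "\<dots> = 4 * (card G - 1)"
    using total by (simp flip: sum_distrib_left)
  also have "\<dots> < 4 * card G"
    using N by simp
  finally have "card axis_classes < 4"
    by simp
  moreover have "card axis_classes \<noteq> 0"
  proof
    assume "card axis_classes = 0"
    then have "G \<subseteq> {mat 1}"
      using finite_axis_classes by (auto simp: axis_classes_def)
    then have "fixed_space G = UNIV"
      by (auto simp: fixed_space_def)
    \<comment> \<open>The term \<open>axis 1 1\<close> is a standard basis vector, unrelated to the
      axes of group elements; it serves as a nonzero vector fixed by the trivial group.\<close>
    moreover have "axis 1 1 \<noteq> (0 :: real^3)"
      by simp
    ultimately show False
      using fixed_space_G by (metis UNIV_I singletonD)
  qed
  moreover have "card axis_classes \<noteq> 1"
  proof
    assume "card axis_classes = 1"
    then obtain C where "axis_classes = {C}"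
      by (auto simp: card_1_singleton_iff)
    \<comment> \<open>A single fiber would contain all \<open>card G - 1\<close> nontrivial
      elements.\<close>
    then show False
      using total card_axis_fiber_bounds(2)[of C] by simp
  qed
  ultimately show ?thesis
    by (simp add: insert_iff) linarith
qed

end

section \<open>The intersection lattice of sets that pairwise meet in a common least set\<close>

lemma poset_isomorphic_pencil:
  fixes Z T :: "'a set" and \<A> :: "'a set set"
  assumes "finite \<A>" and ZT: "Z \<subset> T"
    and bounds: "\<And>A. A \<in> \<A> \<Longrightarrow> Z \<subset> A" "\<And>A. A \<in> \<A> \<Longrightarrow> A \<subset> T"
    and meet: "\<And>A B. A \<in> \<A> \<Longrightarrow> B \<in> \<A> \<Longrightarrow> A \<noteq> B \<Longrightarrow> A \<inter> B = Z"
  shows "poset_isomorphic (intersection_lattice (insert T (insert Z \<A>))) (\<lambda>A B. B \<subseteq> A)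
    (L_carrier (card \<A>)) L_le"
proof -
  let ?C = "insert T (insert Z \<A>)"
  have ge: "Z \<subseteq> X" if "X \<in> ?C" for X
    using that bounds(1) ZT by blast
  have Inter_mem: "\<Inter>\<D> \<in> ?C" if \<D>: "\<D> \<subseteq> ?C" "\<D> \<noteq> {}" for \<D>
  proof -
    have Z: "Z \<subseteq> \<Inter>\<D>"
      using \<D> ge by blast
    \<comment> \<open>Without \<open>Z\<close>, only the number of members from \<open>\<A>\<close>
      matters: none gives \<open>T\<close>, one gives that member, and two already meet in
      \<open>Z\<close>. So intersecting produces no new set.\<close>
    consider "Z \<in> \<D>" | "Z \<notin> \<D>" "\<D> \<inter> \<A> = {}" | A where "Z \<notin> \<D>" "\<D> \<inter> \<A> = {A}"
      | A B where "A \<in> \<D> \<inter> \<A>" "B \<in> \<D> \<inter> \<A>" "A \<noteq> B"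
    proof (cases "Z \<in> \<D> \<or> \<D> \<inter> \<A> = {}")
      case False
      then obtain A where "A \<in> \<D> \<inter> \<A>" by blast
      then show ?thesis
        using False that(3)[of A] that(4)[of A] by blast
    qed (use that(1,2) in blast)
    then show ?thesis
    proof cases
      case 1
      then have "\<Inter>\<D> = Z" using Z by blast
      then show ?thesis by simp
    next
      case 2
      then have "\<D> = {T}" using \<D> by blast
      then show ?thesis by simp
    next
      case 3
      then have "A \<in> \<A>" "A \<in> \<D>" by blast+
      moreover have "A \<subseteq> X" if "X \<in> \<D>" for X
      proof -
        have "X = A" if "X \<in> \<A>"
          using that \<open>X \<in> \<D>\<close> 3(2) by blast
        moreover have "X \<in> ?C" "X \<noteq> Z"
          using that 3(1) \<D>(1) by blast+
        ultimately show ?thesis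
          using bounds(2)[OF \<open>A \<in> \<A>\<close>] by blast
      qed
      ultimately have "\<Inter>\<D> = A" by blast
      then show ?thesis using \<open>A \<in> \<A>\<close> by simp
    next
      case 4
      then have "\<Inter>\<D> \<subseteq> A \<inter> B" by blast
      then have "\<Inter>\<D> = Z" using meet[of A B] 4 Z by blast
      then show ?thesis by simp
    qed
  qed
  have mem_lattice: "X \<in> {\<Inter>\<D> |\<D>. \<D> \<subseteq> ?C \<and> \<D> \<noteq> {}}" if "X \<in> ?C" for X
    using that by (intro CollectI exI[of _ "{X}"]) simp
  have lattice: "intersection_lattice ?C = ?C"
    unfolding intersection_lattice_def
  proof (intro equalityI subsetI)
    fix X assume "X \<in> {\<Inter>\<D> |\<D>. \<D> \<subseteq> ?C \<and> \<D> \<noteq> {}}"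
    then obtain \<D> where \<D>: "X = \<Inter>\<D>" "\<D> \<subseteq> ?C" "\<D> \<noteq> {}"
      by blast
    show "X \<in> ?C"
      unfolding \<D>(1) using \<D>(2,3) by (rule Inter_mem)
  qed (rule mem_lattice)
  obtain b where b: "bij_betw b \<A> {1..card \<A>}"
    using finite_same_card_bij[OF \<open>finite \<A>\<close>, of "{1..card \<A>}"] by auto
  \<comment> \<open>The order is reverse inclusion, so the largest set becomes the minimum and the
    least set the maximum.\<close>
  define f where "f X = (if X = T then LBot else if X = Z then LTop else LAtom (b X))" for X
  have fT: "f T = LBot" and fZ: "f Z = LTop"
    using ZT by (auto simp: f_def)
  have fA: "f A = LAtom (b A)" if "A \<in> \<A>" for A
    using bounds[OF that] by (auto simp: f_def)
  have inj: "b A = b B \<longleftrightarrow> A = B" if "A \<in> \<A>" "B \<in> \<A>" for A B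
    using b that by (auto simp: bij_betw_def inj_on_def)
  have "bij_betw f ?C (L_carrier (card \<A>))"
    unfolding bij_betw_def
  proof
    show "inj_on f ?C"
    proof (rule inj_onI)
      fix X Y assume "X \<in> ?C" "Y \<in> ?C" "f X = f Y"
      then show "X = Y"
        by (elim insertE) (simp_all add: fT fZ fA inj)
    qed
    have "f ` \<A> = LAtom ` (b ` \<A>)"
      by (simp add: fA image_image)
    then have "f ` \<A> = LAtom ` {1..card \<A>}"
      using b by (simp add: bij_betw_def)
    then show "f ` ?C = L_carrier (card \<A>)"
      by (auto simp: fT fZ L_carrier_def)
  qed
  moreover have "Y \<subseteq> X \<longleftrightarrow> L_le (f X) (f Y)" if "X \<in> ?C" "Y \<in> ?C" for X Y
  proof -
    \<comment> \<open>If \<open>B \<subseteq> A\<close> with \<open>A \<noteq> B\<close>, then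
      \<open>B = A \<inter> B = Z\<close>, but \<open>Z\<close> is a proper subset of
      \<open>B\<close>.\<close>
    have "B \<subseteq> A \<longleftrightarrow> A = B" if "A \<in> \<A>" "B \<in> \<A>" for A B
      using meet[OF that] bounds(1)[OF that(2)] by blast
    moreover have "\<not> T \<subseteq> A" "\<not> A \<subseteq> Z" "A \<subseteq> T" "Z \<subseteq> A" if "A \<in> \<A>" for A
      using bounds[OF that] by blast+
    moreover have "Z \<subseteq> T" "\<not> T \<subseteq> Z"
      using ZT by blast+
    ultimately show ?thesis
      using that by (elim insertE) (simp_all add: fT fZ fA inj L_le_def)
  qed
  ultimately show ?thesis
    unfolding poset_isomorphic_def lattice by blast
qed

theorem theorem3:
  fixes G :: "(real^3^3) set"
  assumes "subgroup G GL"
    and "finite G"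
    and "strictly_generated_codim2 G"
    and "fixed_space G = {0}"
  shows "\<exists>n\<in>{2, 3}.
    poset_isomorphic (intersection_lattice (luna_closures G)) (\<lambda>A B. B \<subseteq> A)
      (L_carrier n) L_le"
proof -
  have fin: "finite_matrix_group G"
    by (rule finite_matrix_group_if_subgroup[OF assms(1,2)])
  interpret axial_matrix_group G
  proof (intro axial_matrix_group.intro[OF fin] axial_matrix_group_axioms.intro)
    show "\<exists>u. u \<noteq> 0 \<and> fixed_space {g} = span {u}" if "g \<in> G" "g \<noteq> mat 1" for g
      using axis_of_det_1[OF fin that(1) strictly_generated_codim2_det_1[OF assms(1-3) that(1)] that(2)] .
  qed (rule assms(4))
  \<comment> \<open>Any axis class lies strictly between the image of the origin and the whole
    quotient, which separates the two extremes.\<close>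
  have "axis_classes \<noteq> {}"
  proof
    assume "axis_classes = {}"
    then show False
      using card_axis_classes by simp
  qed
  then obtain C where "C \<in> axis_classes"
    by blast
  then have "{quot_map G 0} \<subset> range (quot_map G)"
    using psubset_trans[OF zero_psubset_axis_class axis_class_psubset] by simp
  then have "poset_isomorphic (intersection_lattice (luna_closures G)) (\<lambda>A B. B \<subseteq> A)
      (L_carrier (card axis_classes)) L_le"
    unfolding luna_closures_axial
    by (rule poset_isomorphic_pencil[OF finite_axis_classes _
          zero_psubset_axis_class axis_class_psubset axis_class_Int])
  then show ?thesis
    using card_axis_classes by (rule bexI)
qed

end
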